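(* Let $V$ be a variety of universal algebras and let $F$ be the free algebra of $V$ freely generated by $X=\{x_1,\dots,x_n\}$. Let $\Phi$ be an automorphism of the semigroup $\mathrm{End}(F)$ and let $\varphi$ be the permutation of $F^n$ corresponding to $\Phi$. Then $$\Phi(\nu)=\delta^{-1}\circ\varphi\circ\nu^{\times n}\circ\varphi^{-1}\circ\delta$$ for every endomorphism $\nu$ of $F$.
   Context: $\mathrm{End}(F)$ is the semigroup of all endomorphisms of $F$ under composition. $F^n$ is the direct power of $n$ copies of $F$, with elements $\vec u=(u_1,\dots,u_n)$; $\Delta=\{(u,\dots,u): u\in F\}$ is its diagonal, and $\delta:F\to\Delta$, $\delta(u)=(u,\dots,u)$, is the natural isomorphism. For an endomorphism $\nu$ of $F$, $\nu^{\times n}=\nu\times\dots\times\nu$ acts on $F^n$ componentwise. For $\vec u\in F^n$, $\alpha_{\vec u}$ denotes the unique endomorphism of $F$ with $\alpha_{\vec u}(x_i)=u_i$ for $i=1,\dots,n$. The permutation $\varphi$ of $F^n$ corresponding to $\Phi$ is defined by: $\varphi(\vec u)=\vec v$ if and only if $\Phi(\alpha_{\vec u})=\alpha_{\vec v}$. The displayed formula includes the assertion that $\varphi\circ\nu^{\times n}\circ\varphi^{-1}$ maps $\Delta$ into $\Delta$, so that the composition makes sense. *)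

theory Defs
  imports "HOL-Algebra.Group"
begin

text \<open>
  A signature is a set of pairs (operation symbol, arity); it may be empty. Algebras are finitary.
  The interpretation of a symbol is only constrained on tuples of carrier elements
  whose length is an arity of the symbol.
\<close>

datatype ('f, 'v) trm = Var 'v | Fun 'f "('f, 'v) trm list"

fun wf_trm :: "('f \<times> nat) set \<Rightarrow> ('f, 'v) trm \<Rightarrow> bool" where
  "wf_trm \<Sigma> (Var v) \<longleftrightarrow> True"
| "wf_trm \<Sigma> (Fun f ts) \<longleftrightarrow> (f, length ts) \<in> \<Sigma> \<and> (\<forall>t \<in> set ts. wf_trm \<Sigma> t)"

record ('f, 'a) ualgebra = "'a partial_object" +
  interp :: "'f \<Rightarrow> 'a list \<Rightarrow> 'a"

definition subuniverse :: "('f \<times> nat) set \<Rightarrow> ('f, 'a) ualgebra \<Rightarrow> 'a set \<Rightarrow> bool" where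
  "subuniverse \<Sigma> A S \<longleftrightarrow> S \<subseteq> carrier A \<and>
     (\<forall>(f, k) \<in> \<Sigma>. \<forall>as. length as = k \<longrightarrow> set as \<subseteq> S \<longrightarrow> interp A f as \<in> S)"

definition is_algebra :: "('f \<times> nat) set \<Rightarrow> ('f, 'a) ualgebra \<Rightarrow> bool" where
  "is_algebra \<Sigma> A \<longleftrightarrow> subuniverse \<Sigma> A (carrier A)"

definition generates :: "('f \<times> nat) set \<Rightarrow> ('f, 'a) ualgebra \<Rightarrow> 'a set \<Rightarrow> bool" where
  "generates \<Sigma> A X \<longleftrightarrow> X \<subseteq> carrier A \<and> (\<forall>S. subuniverse \<Sigma> A S \<longrightarrow> X \<subseteq> S \<longrightarrow> S = carrier A)"

definition is_hom ::
  "('f \<times> nat) set \<Rightarrow> ('f, 'a) ualgebra \<Rightarrow> ('f, 'b) ualgebra \<Rightarrow> ('a \<Rightarrow> 'b) \<Rightarrow> bool" where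
  "is_hom \<Sigma> A B h \<longleftrightarrow> h \<in> carrier A \<rightarrow> carrier B \<and>
     (\<forall>(f, k) \<in> \<Sigma>. \<forall>as. length as = k \<longrightarrow> set as \<subseteq> carrier A \<longrightarrow>
        h (interp A f as) = interp B f (map h as))"

fun eval :: "('f, 'a) ualgebra \<Rightarrow> ('v \<Rightarrow> 'a) \<Rightarrow> ('f, 'v) trm \<Rightarrow> 'a" where
  "eval A \<rho> (Var v) = \<rho> v"
| "eval A \<rho> (Fun f ts) = interp A f (map (eval A \<rho>) ts)"

text \<open>
  A variety is an equational class: it is given by a set of identities in countably many
  variables, and consists of all algebras satisfying them.
\<close>

type_synonym 'f identity = "('f, nat) trm \<times> ('f, nat) trm"

definition identities :: "('f \<times> nat) set \<Rightarrow> 'f identity set \<Rightarrow> bool" where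
  "identities \<Sigma> E \<longleftrightarrow> (\<forall>(s, t) \<in> E. wf_trm \<Sigma> s \<and> wf_trm \<Sigma> t)"

definition in_variety ::
  "('f \<times> nat) set \<Rightarrow> 'f identity set \<Rightarrow> ('f, 'a) ualgebra \<Rightarrow> bool" where
  "in_variety \<Sigma> E A \<longleftrightarrow> is_algebra \<Sigma> A \<and>
     (\<forall>(s, t) \<in> E. \<forall>\<rho>. range \<rho> \<subseteq> carrier A \<longrightarrow> eval A \<rho> s = eval A \<rho> t)"

text \<open>
  The universal mapping property quantifies over all algebras of the variety. A definition can
  only quantify over algebras on one type; sets of terms with variables from the type of
  \<open>F\<close> form a large enough universe: the lemma \<open>free_algebra_extend\<close> below gives
  the property for algebras of the variety on any type. Uniqueness of the extension follows
  from \<open>generates\<close>.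
\<close>

definition free_algebra ::
  "('f \<times> nat) set \<Rightarrow> 'f identity set \<Rightarrow> ('f, 'a) ualgebra \<Rightarrow> 'a set \<Rightarrow> bool" where
  "free_algebra \<Sigma> E F X \<longleftrightarrow> in_variety \<Sigma> E F \<and> generates \<Sigma> F X \<and>
     (\<forall>A :: ('f, ('f, 'a) trm set) ualgebra. in_variety \<Sigma> E A \<longrightarrow>
        (\<forall>g \<in> X \<rightarrow> carrier A. \<exists>h. is_hom \<Sigma> F A h \<and> (\<forall>x \<in> X. h x = g x)))"

text \<open>
  Endomorphisms are represented by functions that are \<open>undefined\<close> outside the carrier, so that
  equality of endomorphisms is equality of functions. A homomorphism between monoid records in
  the sense of \<open>hom\<close> and \<open>iso\<close> preserves the multiplication only, so
  \<open>iso (End \<Sigma> F) (End \<Sigma> F)\<close> is the set of semigroup automorphisms.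
\<close>

definition End :: "('f \<times> nat) set \<Rightarrow> ('f, 'a) ualgebra \<Rightarrow> ('a \<Rightarrow> 'a) monoid" where
  "End \<Sigma> F = \<lparr>carrier = {h \<in> extensional (carrier F). is_hom \<Sigma> F F h},
              monoid.mult = compose (carrier F),
              one = restrict id (carrier F)\<rparr>"

definition cart_power :: "nat \<Rightarrow> 'a set \<Rightarrow> (nat \<Rightarrow> 'a) set" where
  "cart_power n A = {1..n} \<rightarrow>\<^sub>E A"

definition diag :: "nat \<Rightarrow> 'a \<Rightarrow> nat \<Rightarrow> 'a" where
  "diag n u = (\<lambda>i \<in> {1..n}. u)"

definition diagonal :: "nat \<Rightarrow> 'a set \<Rightarrow> (nat \<Rightarrow> 'a) set" where
  "diagonal n A = diag n ` A"

definition power_map :: "nat \<Rightarrow> ('a \<Rightarrow> 'a) \<Rightarrow> (nat \<Rightarrow> 'a) \<Rightarrow> nat \<Rightarrow> 'a" where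
  "power_map n \<nu> u = (\<lambda>i \<in> {1..n}. \<nu> (u i))"

definition endo_of ::
  "('f \<times> nat) set \<Rightarrow> ('f, 'a) ualgebra \<Rightarrow> nat \<Rightarrow> (nat \<Rightarrow> 'a) \<Rightarrow> (nat \<Rightarrow> 'a) \<Rightarrow> 'a \<Rightarrow> 'a" where
  "endo_of \<Sigma> F n x u = (THE \<alpha>. \<alpha> \<in> carrier (End \<Sigma> F) \<and> (\<forall>i \<in> {1..n}. \<alpha> (x i) = u i))"

definition corr_perm ::
  "('f \<times> nat) set \<Rightarrow> ('f, 'a) ualgebra \<Rightarrow> nat \<Rightarrow> (nat \<Rightarrow> 'a) \<Rightarrow> (('a \<Rightarrow> 'a) \<Rightarrow> ('a \<Rightarrow> 'a)) \<Rightarrow>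
   (nat \<Rightarrow> 'a) \<Rightarrow> (nat \<Rightarrow> 'a)" where
  "corr_perm \<Sigma> F n x \<Phi> = (\<lambda>u \<in> cart_power n (carrier F).
     THE v. v \<in> cart_power n (carrier F) \<and> \<Phi> (endo_of \<Sigma> F n x u) = endo_of \<Sigma> F n x v)"


subsection \<open>The definitions behave as intended\<close>

lemma is_homD:
  "is_hom \<Sigma> A B h \<Longrightarrow> (f, length as) \<in> \<Sigma> \<Longrightarrow> set as \<subseteq> carrier A \<Longrightarrow>
     h (interp A f as) = interp B f (map h as)"
  unfolding is_hom_def by blast

lemma hom_eqI:
  assumes gen: "generates \<Sigma> F X" and alg: "is_algebra \<Sigma> F"
    and h: "is_hom \<Sigma> F A h" and k: "is_hom \<Sigma> F A k"
    and X: "\<And>x. x \<in> X \<Longrightarrow> h x = k x" and u: "u \<in> carrier F"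
  shows "h u = k u"
proof -
  let ?S = "{u \<in> carrier F. h u = k u}"
  have "subuniverse \<Sigma> F ?S"
    unfolding subuniverse_def
  proof (intro conjI ballI, goal_cases)
    case (2 p)
    show ?case
    proof (cases p, clarify, goal_cases)
      case (1 f k' as)
      have "map h as = map k as" using 1 by auto
      moreover have "set as \<subseteq> carrier F" using 1 by auto
      moreover have "(f, length as) \<in> \<Sigma>" using 1 2 by auto
      moreover have "interp F f as \<in> carrier F"
        using alg calculation unfolding is_algebra_def subuniverse_def by blast
      ultimately show ?case
        using is_homD[OF h] is_homD[OF k] by metis
    qed
  qed auto
  moreover have "X \<subseteq> ?S" using X gen unfolding generates_def by auto
  ultimately have "?S = carrier F" using gen unfolding generates_def by blast
  then show ?thesis using u by blast
qed

lemma eval_hom: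
  assumes "is_hom \<Sigma> A B h" "is_algebra \<Sigma> A" "range \<rho> \<subseteq> carrier A" "wf_trm \<Sigma> t"
  shows "eval A \<rho> t \<in> carrier A \<and> h (eval A \<rho> t) = eval B (\<lambda>v. h (\<rho> v)) t"
  using assms(4)
proof (induction t)
  case (Var v)
  then show ?case using assms(3) by auto
next
  case (Fun f ts)
  have 1: "set (map (eval A \<rho>) ts) \<subseteq> carrier A" using Fun by auto
  have 2: "(f, length (map (eval A \<rho>) ts)) \<in> \<Sigma>" using Fun by auto
  have 3: "map h (map (eval A \<rho>) ts) = map (eval B (\<lambda>v. h (\<rho> v))) ts" using Fun by auto
  have "interp A f (map (eval A \<rho>) ts) \<in> carrier A"
    using assms(2) 1 2 unfolding is_algebra_def subuniverse_def by blast
  then show ?case using is_homD[OF assms(1) 2 1] by (simp only: eval.simps 3)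
qed

lemma in_variety_mono:
  assumes E: "identities \<Sigma> E" and B: "is_algebra \<Sigma> B" and A: "in_variety \<Sigma> E A"
    and h: "is_hom \<Sigma> B A h" "inj_on h (carrier B)"
  shows "in_variety \<Sigma> E B"
  unfolding in_variety_def
proof (intro conjI B ballI, clarify)
  fix s t and \<rho> :: "nat \<Rightarrow> 'b" assume st: "(s, t) \<in> E" and \<rho>: "range \<rho> \<subseteq> carrier B"
  have wf: "wf_trm \<Sigma> s" "wf_trm \<Sigma> t" using E st unfolding identities_def by auto
  have "range (\<lambda>v. h (\<rho> v)) \<subseteq> carrier A" using \<rho> h(1) unfolding is_hom_def by auto
  then have "eval A (\<lambda>v. h (\<rho> v)) s = eval A (\<lambda>v. h (\<rho> v)) t"
    using A st unfolding in_variety_def by blast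
  then show "eval B \<rho> s = eval B \<rho> t"
    using eval_hom[OF h(1) B \<rho> wf(1)] eval_hom[OF h(1) B \<rho> wf(2)] h(2)
    by (metis inj_onD)
qed

text \<open>
  The subalgebra of \<open>A\<close> generated by the image of \<open>X\<close> is copied into the universe of sets of
  terms: an element is sent to the set of all terms over \<open>X\<close> that denote it.
\<close>

lemma free_algebra_extend:
  fixes F :: "('f, 'a) ualgebra" and A :: "('f, 'b) ualgebra"
  assumes E: "identities \<Sigma> E" and F: "free_algebra \<Sigma> E F X"
    and A: "in_variety \<Sigma> E A" and g: "g \<in> X \<rightarrow> carrier A"
  shows "\<exists>!h. h \<in> extensional (carrier F) \<and> is_hom \<Sigma> F A h \<and> (\<forall>x \<in> X. h x = g x)"
proof -
  define T where "T = {t :: ('f, 'a) trm. wf_trm \<Sigma> t \<and> set2_trm t \<subseteq> X}"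
  define c where "c b = {t \<in> T. eval A g t = b}" for b
  define d where "d s = eval A g (SOME t. t \<in> s)" for s
  define B where "B = eval A g ` T"
  define C where "C = \<lparr>carrier = c ` B, interp = (\<lambda>f ls. c (interp A f (map d ls)))\<rparr>"
  have algA: "is_algebra \<Sigma> A" using A unfolding in_variety_def by blast
  have T_Fun: "Fun f ts \<in> T" if "(f, length ts) \<in> \<Sigma>" "set ts \<subseteq> T" for f ts
    using that unfolding T_def by auto
  have evalT: "eval A g t \<in> carrier A" if "t \<in> T" for t
    using that
  proof (induction t)
    case (Var v)
    then show ?case using g unfolding T_def by auto
  next
    case (Fun f ts)
    have "set (map (eval A g) ts) \<subseteq> carrier A" using Fun unfolding T_def by fastforce
    moreover have "(f, length (map (eval A g) ts)) \<in> \<Sigma>" using Fun unfolding T_def by auto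
    ultimately show ?case
      using algA unfolding is_algebra_def subuniverse_def eval.simps by blast
  qed
  have dc: "d (c b) = b" if "b \<in> B" for b
  proof -
    have "\<exists>t. t \<in> c b" using that unfolding B_def c_def by auto
    then have "(SOME t. t \<in> c b) \<in> c b" by (rule someI_ex)
    then show ?thesis unfolding d_def c_def by auto
  qed
  have B_closed: "interp A f bs \<in> B" if "(f, length bs) \<in> \<Sigma>" "set bs \<subseteq> B" for f bs
  proof -
    have "bs \<in> lists (eval A g ` T)" using \<open>set bs \<subseteq> B\<close> unfolding B_def by auto
    then obtain ts where ts: "bs = map (eval A g) ts" "set ts \<subseteq> T"
      unfolding lists_image by auto
    then have "interp A f bs = eval A g (Fun f ts)" by simp
    moreover have "Fun f ts \<in> T" using T_Fun ts that by simp
    ultimately show ?thesis unfolding B_def by blast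
  qed
  have dB: "d ` carrier C = B" unfolding C_def by (simp add: image_image dc)
  have Cop: "d (interp C f ls) = interp A f (map d ls) \<and> interp C f ls \<in> carrier C"
    if "(f, length ls) \<in> \<Sigma>" "set ls \<subseteq> carrier C" for f ls
  proof -
    have "set (map d ls) \<subseteq> B" using that(2) dB by auto
    then have "interp A f (map d ls) \<in> B" using B_closed[of f "map d ls"] that(1) by simp
    then show ?thesis using dc by (simp add: C_def)
  qed
  have algC: "is_algebra \<Sigma> C" using Cop unfolding is_algebra_def subuniverse_def by blast
  have BA: "B \<subseteq> carrier A" using evalT unfolding B_def by auto
  have homd: "is_hom \<Sigma> C A d" using Cop dB BA unfolding is_hom_def by blast
  have "inj_on d (carrier C)" unfolding C_def by (rule inj_onI) (auto simp: dc)
  with in_variety_mono[OF E algC A homd] have C: "in_variety \<Sigma> E C" by blast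
  have VarT: "Var x \<in> T" if "x \<in> X" for x using that unfolding T_def by auto
  have gB: "g x \<in> B" if "x \<in> X" for x unfolding B_def using VarT[OF that] by force
  then have "(\<lambda>x. c (g x)) \<in> X \<rightarrow> carrier C" unfolding C_def by auto
  then obtain k where k: "is_hom \<Sigma> F C k" "\<forall>x \<in> X. k x = c (g x)"
    using F[unfolded free_algebra_def, THEN conjunct2, THEN conjunct2, rule_format, OF C] by blast
  have algF: "is_algebra \<Sigma> F" and gen: "generates \<Sigma> F X"
    using F unfolding free_algebra_def in_variety_def by auto
  let ?h = "restrict (d \<circ> k) (carrier F)"
  have "is_hom \<Sigma> F A ?h"
    unfolding is_hom_def
  proof (intro conjI ballI, goal_cases)
    case 1
    have "k \<in> carrier F \<rightarrow> carrier C" using k(1) unfolding is_hom_def by blast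
    then show ?case using homd unfolding is_hom_def by (simp add: Pi_iff)
  next
    case (2 p)
    show ?case
    proof (cases p, clarify, goal_cases)
      case (1 f m as)
      have f: "(f, length as) \<in> \<Sigma>" using 1 2 by auto
      have F': "interp F f as \<in> carrier F"
        using algF f 1 unfolding is_algebra_def subuniverse_def by blast
      have "set (map k as) \<subseteq> carrier C" using k(1) 1 unfolding is_hom_def by auto
      then have "d (interp C f (map k as)) = interp A f (map d (map k as))"
        using Cop[of f "map k as"] f by simp
      moreover have "map ?h as = map d (map k as)" using 1 by auto
      ultimately show ?case using F' is_homD[OF k(1) f] 1 by (simp del: map_map map_eq_conv)
    qed
  qed
  moreover have "\<forall>x \<in> X. ?h x = g x"
    using k(2) gB dc gen unfolding generates_def by auto
  ultimately show ?thesis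
  proof (intro ex1I[of _ ?h] conjI, goal_cases)
    case (4 h)
    show ?case
      by (rule extensionalityI[of _ "carrier F"])
        (use 4 hom_eqI[OF gen algF, of A h ?h] in auto)
  qed auto
qed

lemma endo_of:
  assumes E: "identities \<Sigma> E" and x: "inj_on x {1..n}" and F: "free_algebra \<Sigma> E F (x ` {1..n})"
    and u: "u \<in> cart_power n (carrier F)"
  shows "\<alpha> = endo_of \<Sigma> F n x u \<longleftrightarrow> \<alpha> \<in> carrier (End \<Sigma> F) \<and> (\<forall>i \<in> {1..n}. \<alpha> (x i) = u i)"
proof -
  let ?g = "\<lambda>y. u (inv_into {1..n} x y)"
  have V: "in_variety \<Sigma> E F" using F unfolding free_algebra_def by blast
  have "?g \<in> x ` {1..n} \<rightarrow> carrier F"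
    using u x unfolding cart_power_def by (auto simp: PiE_def Pi_def)
  from free_algebra_extend[OF E F V this]
  have "\<exists>!\<alpha>. \<alpha> \<in> carrier (End \<Sigma> F) \<and> (\<forall>i \<in> {1..n}. \<alpha> (x i) = u i)"
    using x by (simp add: End_def)
  from theI'[OF this] this show ?thesis unfolding endo_of_def by auto
qed

lemma corr_perm:
  assumes E: "identities \<Sigma> E" and x: "inj_on x {1..n}" and F: "free_algebra \<Sigma> E F (x ` {1..n})"
    and \<Phi>: "\<Phi> \<in> iso (End \<Sigma> F) (End \<Sigma> F)"
  shows "bij_betw (corr_perm \<Sigma> F n x \<Phi>) (cart_power n (carrier F)) (cart_power n (carrier F))"
    and "\<lbrakk>u \<in> cart_power n (carrier F); v \<in> cart_power n (carrier F)\<rbrakk> \<Longrightarrow>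
      corr_perm \<Sigma> F n x \<Phi> u = v \<longleftrightarrow> \<Phi> (endo_of \<Sigma> F n x u) = endo_of \<Sigma> F n x v"
proof -
  let ?P = "cart_power n (carrier F)" and ?\<alpha> = "endo_of \<Sigma> F n x" and ?E = "carrier (End \<Sigma> F)"
  have bij\<alpha>: "bij_betw ?\<alpha> ?P ?E"
    unfolding bij_betw_def
  proof (intro conjI inj_onI subset_antisym subsetI)
    fix u v assume *: "u \<in> ?P" "v \<in> ?P" "?\<alpha> u = ?\<alpha> v"
    have "\<forall>i \<in> {1..n}. u i = v i"
      using endo_of[OF E x F *(1)] endo_of[OF E x F *(2)] *(3) by metis
    then show "u = v" using * unfolding cart_power_def by (metis PiE_ext)
  next
    fix \<alpha> assume "\<alpha> \<in> ?\<alpha> ` ?P"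
    then show "\<alpha> \<in> ?E" using endo_of[OF E x F] by blast
  next
    fix \<alpha> assume \<alpha>: "\<alpha> \<in> ?E"
    have "x ` {1..n} \<subseteq> carrier F" using F unfolding free_algebra_def generates_def by blast
    then have u: "(\<lambda>i \<in> {1..n}. \<alpha> (x i)) \<in> ?P"
      using \<alpha> unfolding End_def is_hom_def cart_power_def by auto
    then show "\<alpha> \<in> ?\<alpha> ` ?P" using endo_of[OF E x F u, of \<alpha>] \<alpha> by auto
  qed
  have bij\<Phi>: "bij_betw \<Phi> ?E ?E" using \<Phi> unfolding iso_def by auto
  have ex1: "\<exists>!v. v \<in> ?P \<and> \<Phi> (?\<alpha> u) = ?\<alpha> v" if "u \<in> ?P" for u
  proof -
    have "\<Phi> (?\<alpha> u) \<in> ?E" using that bij\<alpha> bij\<Phi> by (auto dest: bij_betw_apply)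
    then obtain v where "v \<in> ?P" "?\<alpha> v = \<Phi> (?\<alpha> u)"
      using bij_betw_imp_surj_on[OF bij\<alpha>] by (metis imageE)
    then show ?thesis using inj_onD[OF bij_betw_imp_inj_on[OF bij\<alpha>]] by (intro ex1I[of _ v]) auto
  qed
  have val: "corr_perm \<Sigma> F n x \<Phi> u \<in> ?P \<and> \<Phi> (?\<alpha> u) = ?\<alpha> (corr_perm \<Sigma> F n x \<Phi> u)" if "u \<in> ?P" for u
    using theI'[OF ex1[OF that]] that unfolding corr_perm_def by simp
  show iff: "corr_perm \<Sigma> F n x \<Phi> u = v \<longleftrightarrow> \<Phi> (?\<alpha> u) = ?\<alpha> v" if "u \<in> ?P" "v \<in> ?P" for u v
    using val[OF that(1)] that(2) inj_onD[OF bij_betw_imp_inj_on[OF bij\<alpha>]] by auto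
  show "bij_betw (corr_perm \<Sigma> F n x \<Phi>) ?P ?P"
    unfolding bij_betw_def
  proof (intro conjI inj_onI subset_antisym subsetI)
    fix u v assume *: "u \<in> ?P" "v \<in> ?P" "corr_perm \<Sigma> F n x \<Phi> u = corr_perm \<Sigma> F n x \<Phi> v"
    then have "\<Phi> (?\<alpha> u) = \<Phi> (?\<alpha> v)" using val[OF *(1)] val[OF *(2)] by simp
    then show "u = v"
      using inj_onD[OF bij_betw_imp_inj_on[OF bij_betw_trans[OF bij\<alpha> bij\<Phi>]], of u v] * by simp
  next
    fix v assume "v \<in> corr_perm \<Sigma> F n x \<Phi> ` ?P"
    then show "v \<in> ?P" using val by blast
  next
    fix v assume v: "v \<in> ?P"
    then have "?\<alpha> v \<in> ?E" using bij\<alpha> by (rule bij_betw_apply[rotated])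
    then have "?\<alpha> v \<in> (\<Phi> \<circ> ?\<alpha>) ` ?P"
      using bij_betw_imp_surj_on[OF bij_betw_trans[OF bij\<alpha> bij\<Phi>]] by simp
    then obtain u where "u \<in> ?P" "\<Phi> (?\<alpha> u) = ?\<alpha> v" by auto
    then show "v \<in> corr_perm \<Sigma> F n x \<Phi> ` ?P" using iff v by blast
  qed
qed

end

theory Submission
  imports Defs
begin

text \<open>
  A composite \<open>\<mu> \<circ> \<alpha>\<^sub>u\<close> sends \<open>x\<^sub>i\<close> to \<open>\<mu> (u\<^sub>i)\<close>, so under the bijection
  \<open>u \<mapsto> \<alpha>\<^sub>u\<close> between \<open>F\<^sup>n\<close> and the endomorphisms, left multiplication by
  \<open>\<mu>\<close> becomes the componentwise action \<open>\<mu>\<^sup>\<times>\<^sup>n\<close> (lemma \<open>endo_of_power_map\<close>).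
  Since \<open>\<Phi>\<close> carries left multiplication by \<open>\<nu>\<close> to left multiplication by \<open>\<Phi> \<nu>\<close>,
  its transport \<open>\<phi>\<close> to \<open>F\<^sup>n\<close> intertwines the two componentwise actions:
  \<open>\<phi> \<circ> \<nu>\<^sup>\<times>\<^sup>n = (\<Phi> \<nu>)\<^sup>\<times>\<^sup>n \<circ> \<phi>\<close> on \<open>F\<^sup>n\<close> (lemma \<open>corr_perm_power_map\<close>).
  Hence the conjugate \<open>\<phi> \<circ> \<nu>\<^sup>\<times>\<^sup>n \<circ> \<phi>\<^sup>-\<^sup>1\<close> is \<open>(\<Phi> \<nu>)\<^sup>\<times>\<^sup>n\<close>, which preserves the
  diagonal and acts there as \<open>\<Phi> \<nu>\<close>.
\<close>

lemma End_closed: "\<mu> \<in> carrier (End \<Sigma> F) \<Longrightarrow> a \<in> carrier F \<Longrightarrow> \<mu> a \<in> carrier F"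
  unfolding End_def is_hom_def by auto

lemma End_compose_closed:
  assumes "is_algebra \<Sigma> F" and \<mu>: "\<mu> \<in> carrier (End \<Sigma> F)" and \<nu>: "\<nu> \<in> carrier (End \<Sigma> F)"
  shows "compose (carrier F) \<mu> \<nu> \<in> carrier (End \<Sigma> F)"
proof -
  have hom: "is_hom \<Sigma> F F \<mu>" "is_hom \<Sigma> F F \<nu>"
    using \<mu> \<nu> unfolding End_def by auto
  have "compose (carrier F) \<mu> \<nu> (interp F f as) = interp F f (map (compose (carrier F) \<mu> \<nu>) as)"
    if f: "(f, length as) \<in> \<Sigma>" and as: "set as \<subseteq> carrier F" for f as
  proof -
    have "interp F f as \<in> carrier F"
      using assms(1) f as unfolding is_algebra_def subuniverse_def by blast
    moreover have "set (map \<nu> as) \<subseteq> carrier F"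
      using as End_closed[OF \<nu>] by auto
    moreover have "map (compose (carrier F) \<mu> \<nu>) as = map \<mu> (map \<nu> as)"
      using as by (auto simp: compose_def)
    ultimately show ?thesis
      using is_homD[OF hom(2) f as] is_homD[OF hom(1), of f "map \<nu> as"] f
      by (simp add: compose_eq del: map_map map_eq_conv)
  qed
  then show ?thesis
    using End_closed[OF \<mu>] End_closed[OF \<nu>]
    unfolding End_def is_hom_def by (auto simp: compose_eq)
qed

lemma power_map_closed:
  "\<mu> \<in> carrier (End \<Sigma> F) \<Longrightarrow> u \<in> cart_power n (carrier F) \<Longrightarrow>
    power_map n \<mu> u \<in> cart_power n (carrier F)"
  unfolding power_map_def cart_power_def by (auto intro: End_closed)

lemma diag_closed: "a \<in> A \<Longrightarrow> diag n a \<in> cart_power n A"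
  unfolding diag_def cart_power_def by auto

lemma power_map_diag: "power_map n \<mu> (diag n a) = diag n (\<mu> a)"
  unfolding power_map_def diag_def by auto

lemma inj_diag: "n \<ge> 1 \<Longrightarrow> inj (diag n)"
  unfolding diag_def by (rule injI) (auto dest: fun_cong[of _ _ 1])

text \<open>
  Both sides are endomorphisms, and they agree on the free generators.
\<close>

lemma endo_of_power_map:
  assumes E: "identities \<Sigma> E" and x: "inj_on x {1..n}" and F: "free_algebra \<Sigma> E F (x ` {1..n})"
    and \<mu>: "\<mu> \<in> carrier (End \<Sigma> F)" and u: "u \<in> cart_power n (carrier F)"
  shows "endo_of \<Sigma> F n x (power_map n \<mu> u) = compose (carrier F) \<mu> (endo_of \<Sigma> F n x u)"
proof -
  let ?\<alpha> = "endo_of \<Sigma> F n x u"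
  have alg: "is_algebra \<Sigma> F" and X: "x ` {1..n} \<subseteq> carrier F"
    using F unfolding free_algebra_def in_variety_def generates_def by auto
  have \<alpha>: "?\<alpha> \<in> carrier (End \<Sigma> F)" "\<forall>i \<in> {1..n}. ?\<alpha> (x i) = u i"
    using endo_of[OF E x F u] by auto
  have "\<forall>i \<in> {1..n}. compose (carrier F) \<mu> ?\<alpha> (x i) = power_map n \<mu> u i"
    using \<alpha>(2) X by (auto simp: compose_eq power_map_def image_subset_iff)
  then show ?thesis
    using endo_of[OF E x F power_map_closed[OF \<mu> u]] End_compose_closed[OF alg \<mu> \<alpha>(1)] by metis
qed

text \<open>
  This is multiplicativity of \<open>\<Phi>\<close>, in the form
  \<open>\<Phi> (\<nu> \<circ> \<alpha>\<^sub>u) = \<Phi> \<nu> \<circ> \<Phi> \<alpha>\<^sub>u\<close>, read off on tuples.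
\<close>

lemma corr_perm_power_map:
  assumes E: "identities \<Sigma> E" and x: "inj_on x {1..n}" and F: "free_algebra \<Sigma> E F (x ` {1..n})"
    and \<Phi>: "\<Phi> \<in> iso (End \<Sigma> F) (End \<Sigma> F)" and \<nu>: "\<nu> \<in> carrier (End \<Sigma> F)"
    and u: "u \<in> cart_power n (carrier F)"
  shows "corr_perm \<Sigma> F n x \<Phi> (power_map n \<nu> u) = power_map n (\<Phi> \<nu>) (corr_perm \<Sigma> F n x \<Phi> u)"
proof -
  let ?\<phi> = "corr_perm \<Sigma> F n x \<Phi>" and ?\<alpha> = "endo_of \<Sigma> F n x"
  have \<phi>u: "?\<phi> u \<in> cart_power n (carrier F)"
    using corr_perm(1)[OF E x F \<Phi>] u by (rule bij_betw_apply)
  have \<Phi>\<nu>: "\<Phi> \<nu> \<in> carrier (End \<Sigma> F)"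
    using \<Phi> \<nu> unfolding iso_def hom_def by auto
  have "?\<alpha> u \<in> carrier (End \<Sigma> F)"
    using endo_of[OF E x F u] by auto
  then have "\<Phi> (compose (carrier F) \<nu> (?\<alpha> u)) = compose (carrier F) (\<Phi> \<nu>) (\<Phi> (?\<alpha> u))"
    using \<Phi> \<nu> hom_mult[of \<Phi> "End \<Sigma> F" "End \<Sigma> F" \<nu> "?\<alpha> u"] by (simp add: iso_def End_def)
  also have "\<Phi> (?\<alpha> u) = ?\<alpha> (?\<phi> u)"
    using corr_perm(2)[OF E x F \<Phi> u \<phi>u] by simp
  finally have "\<Phi> (?\<alpha> (power_map n \<nu> u)) = ?\<alpha> (power_map n (\<Phi> \<nu>) (?\<phi> u))"
    by (simp add: endo_of_power_map[OF E x F \<nu> u] endo_of_power_map[OF E x F \<Phi>\<nu> \<phi>u])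
  then show ?thesis
    using corr_perm(2)[OF E x F \<Phi> power_map_closed[OF \<nu> u] power_map_closed[OF \<Phi>\<nu> \<phi>u]] by simp
qed

theorem theorem1:
  fixes \<Sigma> :: "('f \<times> nat) set" and E :: "'f identity set" and F :: "('f, 'a) ualgebra"
    and n :: nat and x :: "nat \<Rightarrow> 'a" and \<Phi> :: "('a \<Rightarrow> 'a) \<Rightarrow> ('a \<Rightarrow> 'a)" and \<nu> :: "'a \<Rightarrow> 'a"
  assumes "identities \<Sigma> E"
    and "n \<ge> 1"
    and "inj_on x {1..n}"
    and "free_algebra \<Sigma> E F (x ` {1..n})"
    and "\<Phi> \<in> iso (End \<Sigma> F) (End \<Sigma> F)"
    and "\<nu> \<in> carrier (End \<Sigma> F)"
  shows "let \<phi> = corr_perm \<Sigma> F n x \<Phi>;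
             \<phi>_inv = inv_into (cart_power n (carrier F)) \<phi>;
             \<delta> = diag n;
             \<delta>_inv = inv_into (carrier F) \<delta>
         in (\<phi> \<circ> power_map n \<nu> \<circ> \<phi>_inv) ` diagonal n (carrier F) \<subseteq> diagonal n (carrier F) \<and>
            \<Phi> \<nu> = restrict (\<delta>_inv \<circ> \<phi> \<circ> power_map n \<nu> \<circ> \<phi>_inv \<circ> \<delta>) (carrier F)"
proof -
  let ?P = "cart_power n (carrier F)" and ?\<phi> = "corr_perm \<Sigma> F n x \<Phi>"
  have \<Phi>\<nu>: "\<Phi> \<nu> \<in> carrier (End \<Sigma> F)"
    using assms(5,6) unfolding iso_def hom_def by auto
  have bij: "bij_betw ?\<phi> ?P ?P"
    using corr_perm(1)[OF assms(1,3,4,5)] .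
  have conj: "?\<phi> (power_map n \<nu> (inv_into ?P ?\<phi> (diag n a))) = diag n (\<Phi> \<nu> a)"
    if a: "a \<in> carrier F" for a
  proof -
    have d: "diag n a \<in> ?\<phi> ` ?P"
      using bij_betw_imp_surj_on[OF bij] diag_closed[OF a] by simp
    show ?thesis
      using corr_perm_power_map[OF assms(1,3,4,5,6) inv_into_into[OF d]]
      by (simp add: f_inv_into_f[OF d] power_map_diag)
  qed
  have \<delta>_inv: "inv_into (carrier F) (diag n) (diag n a) = a" if "a \<in> carrier F" for a
    using inv_into_f_f[OF inj_on_subset[OF inj_diag[OF assms(2)] subset_UNIV] that] .
  have "\<Phi> \<nu> = restrict (inv_into (carrier F) (diag n) \<circ> ?\<phi> \<circ> power_map n \<nu> \<circ> inv_into ?P ?\<phi> \<circ> diag n)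
      (carrier F)"
  proof (rule extensionalityI[of _ "carrier F"])
    show "\<Phi> \<nu> \<in> extensional (carrier F)"
      using \<Phi>\<nu> unfolding End_def by simp
  qed (simp_all add: conj \<delta>_inv End_closed[OF \<Phi>\<nu>])
  moreover have "(?\<phi> \<circ> power_map n \<nu> \<circ> inv_into ?P ?\<phi>) ` diagonal n (carrier F)
      \<subseteq> diagonal n (carrier F)"
    unfolding diagonal_def by (auto simp: conj End_closed[OF \<Phi>\<nu>])
  ultimately show ?thesis
    unfolding Let_def by blast
qed

end
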